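(* Consider the method: choose $H \ge L_2$, $x_0 \in \mathrm{dom}\,\psi$ and $F'_0 \in \partial F(x_0)$; for $k \ge 0$ set $g_k = \|F'_k\|_*$, $A_k = \frac{1}{\sigma}\sqrt{\frac{H}{3}g_k}$, $x_{k+1} = T_{A_k}(x_k)$, and $$F'_{k+1} = \nabla f(x_{k+1}) - \nabla f(x_k) - \nabla^2 f(x_k)(x_{k+1} - x_k) - A_k(\nabla d(x_{k+1}) - \nabla d(x_k)).$$ Let $x^*$ be a minimizer of $F$ on $\mathrm{dom}\,\psi$ and assume $D = \sup_{x\in\mathrm{dom}\,\psi}\{\|x - x^*\| : F(x)\le F(x_0)\} < +\infty$. Let $\delta>0$ and let $N$ be such that $g_k = \|F'_k\|_* \ge \delta$ for all $0\le k\le N$. Then $$N \;\le\; 2c^2\sqrt{\frac{3HD^2}{\delta}} + \frac32\ln\frac{g_0}{\delta} + \ln c, \qquad c = \sigma^{-1} + \frac{3L_2}{2H}.$$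
   Context: $\mathbb{E}$ is a finite-dimensional real vector space with an arbitrary norm $\|\cdot\|$; $\mathbb{E}^*$ is its dual with dual norm $\|g\|_* = \max\{\langle g, x\rangle : \|x\|\le 1\}$; for a self-adjoint linear operator $B:\mathbb{E}\to\mathbb{E}^*$, $\|B\| = \max\{|\langle Bx,x\rangle| : \|x\|\le 1\}$. $F = f + \psi$, where $\psi$ is a closed convex function with $\mathrm{dom}\,\psi \subseteq \mathbb{E}$ and $f$ is convex and twice continuously differentiable with $\|\nabla^2 f(x) - \nabla^2 f(y)\| \le L_2\|x-y\|$ for all $x,y\in\mathrm{dom}\,\psi$. The scaling function $d$ is differentiable and satisfies, for some $\sigma\in(0,1]$ and all $x,y \in \mathrm{dom}\,\psi$: $d(y) \ge d(x) + \langle \nabla d(x), y-x\rangle + \frac{\sigma}{2}\|y-x\|^2$ and $\|\nabla d(x) - \nabla d(y)\|_* \le \|x-y\|$. Bregman distance: $\rho(x,y) = d(y) - d(x) - \langle \nabla d(x), y-x\rangle$. For $\bar x\in\mathrm{dom}\,\psi$ and $A>0$, $$T_A(\bar x) = \arg\min_{y\in\mathrm{dom}\,\psi}\Big[ f(\bar x) + \langle \nabla f(\bar x), y-\bar x\rangle + \tfrac12 \langle \nabla^2 f(\bar x)(y-\bar x), y-\bar x\rangle + A\rho(\bar x,y) + \psi(y)\Big].$$ *)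

theory Defs
  imports "HOL-Analysis.Analysis"
begin

text \<open>The space E is modelled by a Euclidean type 'a (only used as a carrier
of a finite-dimensional real vector space); the dual space E* is identified
with 'a via the inner product, so the pairing is g \<bullet> x. The norm of E is an
arbitrary norm nrm, not the Euclidean one.\<close>

definition is_norm :: "('a::real_vector \<Rightarrow> real) \<Rightarrow> bool" where
  "is_norm nrm \<longleftrightarrow>
     (\<forall>x y. nrm (x + y) \<le> nrm x + nrm y) \<and>
     (\<forall>c x. nrm (c *\<^sub>R x) = \<bar>c\<bar> * nrm x) \<and>
     (\<forall>x. nrm x = 0 \<longrightarrow> x = 0)"

definition dual_norm :: "('a::real_inner \<Rightarrow> real) \<Rightarrow> 'a \<Rightarrow> real" where
  "dual_norm nrm g = Sup {g \<bullet> x | x. nrm x \<le> 1}"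

text \<open>Norm of a (self-adjoint) operator B : E \<rightarrow> E*: max of |Bx x| over the unit ball.\<close>
definition op_norm :: "('a::real_inner \<Rightarrow> real) \<Rightarrow> ('a \<Rightarrow> 'a) \<Rightarrow> real" where
  "op_norm nrm B = Sup {\<bar>B x \<bullet> x\<bar> | x. nrm x \<le> 1}"

text \<open>Closed convex function psi with domain Q (psi = +\<infinity> outside Q):
Q convex, psi convex on Q, epigraph closed.\<close>
definition closed_convex_fun :: "'a::real_normed_vector set \<Rightarrow> ('a \<Rightarrow> real) \<Rightarrow> bool" where
  "closed_convex_fun Q psi \<longleftrightarrow> convex Q \<and> convex_on Q psi \<and>
     closed {(x, t). x \<in> Q \<and> psi x \<le> t}"

definition bregman :: "('a::real_inner \<Rightarrow> real) \<Rightarrow> ('a \<Rightarrow> 'a) \<Rightarrow> 'a \<Rightarrow> 'a \<Rightarrow> real" where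
  "bregman d gd x y = d y - d x - gd x \<bullet> (y - x)"

definition newton_model ::
  "('a::real_inner \<Rightarrow> real) \<Rightarrow> ('a \<Rightarrow> 'a) \<Rightarrow> ('a \<Rightarrow> 'a \<Rightarrow> 'a) \<Rightarrow>
   ('a \<Rightarrow> real) \<Rightarrow> ('a \<Rightarrow> 'a) \<Rightarrow> ('a \<Rightarrow> real) \<Rightarrow> real \<Rightarrow> 'a \<Rightarrow> 'a \<Rightarrow> real" where
  "newton_model f gf Hf d gd psi A xb y =
     f xb + gf xb \<bullet> (y - xb) + 1/2 * (Hf xb (y - xb) \<bullet> (y - xb))
     + A * bregman d gd xb y + psi y"

text \<open>y is T_A(xb): the minimizer of the model over Q (unique for A > 0).\<close>
definition is_T :: "'a::real_inner set \<Rightarrow> ('a \<Rightarrow> real) \<Rightarrow> ('a \<Rightarrow> 'a) \<Rightarrow> ('a \<Rightarrow> 'a \<Rightarrow> 'a) \<Rightarrow>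
   ('a \<Rightarrow> real) \<Rightarrow> ('a \<Rightarrow> 'a) \<Rightarrow> ('a \<Rightarrow> real) \<Rightarrow> real \<Rightarrow> 'a \<Rightarrow> 'a \<Rightarrow> bool" where
  "is_T Q f gf Hf d gd psi A xb y \<longleftrightarrow> y \<in> Q \<and>
     (\<forall>z\<in>Q. newton_model f gf Hf d gd psi A xb y \<le> newton_model f gf Hf d gd psi A xb z)"

text \<open>Subdifferential of F = f + psi (psi = +\<infinity> off Q) at x.\<close>
definition subgrad :: "'a::real_inner set \<Rightarrow> ('a \<Rightarrow> real) \<Rightarrow> 'a \<Rightarrow> 'a set" where
  "subgrad Q F x = {g. \<forall>y\<in>Q. F y \<ge> F x + g \<bullet> (y - x)}"

end

theory Submission
  imports Defs
begin

text \<open>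
  Write \<open>g = g\<^sub>k\<close>, \<open>g' = g\<^sub>k\<^sub>+\<^sub>1\<close>, \<open>r = \<parallel>x\<^sub>k\<^sub>+\<^sub>1 - x\<^sub>k\<parallel>\<close>, \<open>S = \<sigma> A\<^sub>k = sqrt (H g / 3)\<close>,
  \<open>\<lambda> = L\<^sub>2 / H\<close> and \<open>t = S r / g\<close>. Optimality of the step and monotonicity of the subdifferential
  give \<open>t \<le> 1\<close>; the Lipschitz condition gives \<open>g' / g \<le> t / \<sigma> + 3 \<lambda> t\<^sup>2\<close> and
  \<open>F(x\<^sub>k) - F(x\<^sub>k\<^sub>+\<^sub>1) \<ge> (g\<^sup>2 / S) (t\<^sup>2 - \<lambda> t\<^sup>3 / 2)\<close>. Because the operator norm only
  controls quadratic forms, the gradient residual is bounded by \<open>L\<^sub>2 r\<^sup>2\<close> rather than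
  \<open>L\<^sub>2 r\<^sup>2 / 2\<close>, so the estimate \<open>g' \<le> c g\<close> is not available. It is replaced by the
  elementary inequality \<open>2 c\<^sup>2 (t\<^sup>2 - \<lambda> t\<^sup>3 / 2) \<ge> 1 + 3/2 ln (g' / g)\<close>: a step with little
  progress must shrink the gradient. As \<open>g\<close> dominates both \<open>\<delta>\<close> and \<open>(F(x\<^sub>k) - F(x\<^sup>*)) / D\<close>,
  a bounded concave potential of \<open>F(x\<^sub>k) - F(x\<^sup>*)\<close> turns the left-hand side into a telescoping sum.
\<close>

section \<open>Arbitrary norms, dual norms and quadratic forms\<close>

lemma is_norm_nonneg:
  assumes "is_norm nrm" shows "0 \<le> nrm x"
proof -
  have "nrm (x + (-1) *\<^sub>R x) \<le> nrm x + nrm ((-1) *\<^sub>R x)"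
    using assms unfolding is_norm_def by blast
  moreover have "nrm ((-1) *\<^sub>R x) = nrm x" "nrm (0 *\<^sub>R x) = 0"
    using assms unfolding is_norm_def by (metis abs_minus_cancel abs_one mult_1, metis abs_zero mult_zero_left)
  ultimately show ?thesis by simp
qed

lemma is_norm_triangle: "is_norm nrm \<Longrightarrow> nrm (x + y) \<le> nrm x + nrm y"
  and is_norm_scaleR: "is_norm nrm \<Longrightarrow> nrm (s *\<^sub>R x) = \<bar>s\<bar> * nrm x"
  and is_norm_eq_0: "is_norm nrm \<Longrightarrow> nrm x = 0 \<Longrightarrow> x = 0"
  unfolding is_norm_def by blast+

lemma is_norm_zero: "is_norm nrm \<Longrightarrow> nrm 0 = 0"
  using is_norm_scaleR[of nrm 0 0] by simp

lemma is_norm_minus: "is_norm nrm \<Longrightarrow> nrm (- x) = nrm x"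
  using is_norm_scaleR[of nrm "-1" x] by simp

lemma is_norm_minus_commute: "is_norm nrm \<Longrightarrow> nrm (x - y) = nrm (y - x)"
  using is_norm_minus[of nrm "x - y"] by simp

lemma is_norm_diff: "is_norm nrm \<Longrightarrow> nrm (x - y) \<le> nrm x + nrm y"
  using is_norm_triangle[of nrm x "- y"] by (simp add: is_norm_minus)

text \<open>A convex function on a finite-dimensional space is continuous, so \<open>nrm\<close>
  attains a positive minimum on the Euclidean sphere. The estimate keeps the sets inside
  \<open>dual_norm\<close> and \<open>op_norm\<close> bounded above; on an unbounded set
  \<open>Sup\<close> would say nothing.\<close>

lemma is_norm_dominates_norm:
  fixes nrm :: "'a::euclidean_space \<Rightarrow> real"
  assumes "is_norm nrm"
  obtains C where "C > 0" "\<And>x. norm x \<le> C * nrm x"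
proof -
  have "convex_on UNIV nrm"
  proof (rule convex_onI)
    fix t :: real and x y assume "0 < t" "t < 1"
    then show "nrm ((1 - t) *\<^sub>R x + t *\<^sub>R y) \<le> (1 - t) * nrm x + t * nrm y"
      using is_norm_triangle[OF assms, of "(1 - t) *\<^sub>R x" "t *\<^sub>R y"]
      by (simp add: is_norm_scaleR[OF assms])
  qed simp
  then have "continuous_on UNIV nrm" by (simp add: convex_on_continuous)
  then have cont: "continuous_on (sphere 0 1) nrm" by (rule continuous_on_subset) simp
  have "sphere (0::'a) 1 \<noteq> {}" by simp
  then obtain z where z: "z \<in> sphere 0 1" "\<And>y. y \<in> sphere 0 1 \<Longrightarrow> nrm z \<le> nrm y"
    using continuous_attains_inf[OF compact_sphere _ cont] by blast
  have "nrm z \<noteq> 0" using z(1) is_norm_eq_0[OF assms, of z] by auto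
  then have pos: "nrm z > 0" using is_norm_nonneg[OF assms, of z] by simp
  have "norm x \<le> (1 / nrm z) * nrm x" for x
  proof (cases "x = 0")
    case True then show ?thesis by (simp add: is_norm_zero[OF assms])
  next
    case False
    then have "nrm z \<le> nrm ((1 / norm x) *\<^sub>R x)" by (intro z(2)) simp
    with False pos show ?thesis by (simp add: is_norm_scaleR[OF assms] field_simps)
  qed
  with pos show ?thesis by (intro that[of "1 / nrm z"]) auto
qed

lemma bdd_above_dual_norm:
  fixes nrm :: "'a::euclidean_space \<Rightarrow> real"
  assumes "is_norm nrm"
  shows "bdd_above {g \<bullet> x | x. nrm x \<le> 1}"
proof -
  obtain C where C: "C > 0" "\<And>x. norm x \<le> C * nrm x" using is_norm_dominates_norm[OF assms] by blast
  have "g \<bullet> x \<le> norm g * C" if "nrm x \<le> 1" for x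
  proof -
    have "g \<bullet> x \<le> norm g * norm x" by (rule norm_cauchy_schwarz)
    also have "norm x \<le> C" using C(2)[of x] mult_left_mono[OF that, of C] C(1) by linarith
    finally show ?thesis by (simp add: mult_left_mono)
  qed
  then show ?thesis by (intro bdd_aboveI[of _ "norm g * C"]) auto
qed

lemma inner_le_dual_norm:
  fixes nrm :: "'a::euclidean_space \<Rightarrow> real"
  assumes "is_norm nrm"
  shows "g \<bullet> x \<le> dual_norm nrm g * nrm x"
proof (cases "x = 0")
  case True then show ?thesis by (simp add: is_norm_zero[OF assms])
next
  case False
  then have pos: "nrm x > 0"
    using is_norm_nonneg[OF assms, of x] is_norm_eq_0[OF assms, of x] by linarith
  then have "g \<bullet> ((1 / nrm x) *\<^sub>R x) \<le> dual_norm nrm g"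
    unfolding dual_norm_def
    by (intro cSup_upper bdd_above_dual_norm[OF assms])
      (auto intro!: exI[of _ "(1 / nrm x) *\<^sub>R x"] simp: is_norm_scaleR[OF assms])
  with pos show ?thesis by (simp add: field_simps)
qed

lemma dual_norm_leI:
  assumes "is_norm nrm" "\<And>x. nrm x \<le> 1 \<Longrightarrow> g \<bullet> x \<le> K"
  shows "dual_norm nrm g \<le> K"
proof -
  have "nrm 0 \<le> 1" by (simp add: is_norm_zero[OF assms(1)])
  then show ?thesis
    unfolding dual_norm_def by (intro cSup_least) (use assms(2) in auto)
qed

lemma dual_norm_nonneg:
  fixes nrm :: "'a::euclidean_space \<Rightarrow> real"
  assumes "is_norm nrm"
  shows "0 \<le> dual_norm nrm g"
  unfolding dual_norm_def
  by (rule cSup_upper[OF _ bdd_above_dual_norm[OF assms]])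
    (auto intro!: exI[of _ 0] simp: is_norm_zero[OF assms])

lemma dual_norm_diff_scaleR_le:
  fixes nrm :: "'a::euclidean_space \<Rightarrow> real"
  assumes nrm: "is_norm nrm" and s: "s \<ge> 0"
  shows "dual_norm nrm (a - s *\<^sub>R b) \<le> dual_norm nrm a + s * dual_norm nrm b"
proof (rule dual_norm_leI[OF nrm])
  fix v assume v: "nrm v \<le> 1"
  have "g \<bullet> w \<le> dual_norm nrm g" if "nrm w \<le> 1" for g w
    using inner_le_dual_norm[OF nrm, of g w] mult_left_mono[OF that dual_norm_nonneg[OF nrm, of g]]
    by simp
  from this[of v a] this[of "- v" b] v have "a \<bullet> v \<le> dual_norm nrm a" "- (b \<bullet> v) \<le> dual_norm nrm b"
    by (auto simp: is_norm_minus[OF nrm])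
  with mult_left_mono[OF this(2) s] show "(a - s *\<^sub>R b) \<bullet> v \<le> dual_norm nrm a + s * dual_norm nrm b"
    by (simp add: inner_diff_left)
qed

lemma quadratic_form_le_op_norm:
  fixes nrm :: "'a::euclidean_space \<Rightarrow> real"
  assumes "is_norm nrm" "bounded_linear B"
  shows "\<bar>B x \<bullet> x\<bar> \<le> op_norm nrm B * (nrm x)\<^sup>2"
proof (cases "x = 0")
  case True then show ?thesis by (simp add: is_norm_zero[OF assms(1)])
next
  case False
  interpret bounded_linear B by fact
  obtain C where C: "C > 0" "\<And>x. norm x \<le> C * nrm x" using is_norm_dominates_norm[OF assms(1)] by blast
  obtain K where K: "K \<ge> 0" "\<And>x. norm (B x) \<le> norm x * K" using nonneg_bounded by blast
  have "\<bar>B y \<bullet> y\<bar> \<le> C * K * C" if "nrm y \<le> 1" for y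
  proof -
    have y: "norm y \<le> C" using C(2)[of y] mult_left_mono[OF that, of C] C(1) by linarith
    have "\<bar>B y \<bullet> y\<bar> \<le> norm (B y) * norm y" by (rule Cauchy_Schwarz_ineq2)
    also have "\<dots> \<le> (norm y * K) * norm y" by (intro mult_right_mono K) simp
    also have "\<dots> \<le> (C * K) * C" using y K C by (intro mult_mono) auto
    finally show ?thesis .
  qed
  then have bdd: "bdd_above {\<bar>B y \<bullet> y\<bar> | y. nrm y \<le> 1}"
    by (intro bdd_aboveI[of _ "C * K * C"]) auto
  have pos: "nrm x > 0"
    using False is_norm_nonneg[OF assms(1), of x] is_norm_eq_0[OF assms(1), of x] by linarith
  then have "\<bar>B ((1 / nrm x) *\<^sub>R x) \<bullet> ((1 / nrm x) *\<^sub>R x)\<bar> \<le> op_norm nrm B"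
    unfolding op_norm_def
    by (intro cSup_upper bdd)
      (auto intro!: exI[of _ "(1 / nrm x) *\<^sub>R x"] simp: is_norm_scaleR[OF assms(1)])
  with pos show ?thesis
    by (simp add: scaleR abs_mult field_simps power2_eq_square)
qed

text \<open>For an arbitrary norm the factor 2 cannot be improved: it is attained by the quadratic
  form 4ab on the plane with the norm |a| + |b|.\<close>

lemma bilinear_le_two_quadratic:
  fixes nrm :: "'a::real_inner \<Rightarrow> real"
  assumes nrm: "is_norm nrm" and B: "linear B"
    and sym: "\<And>u v. B u \<bullet> v = B v \<bullet> u"
    and K: "\<And>u. \<bar>B u \<bullet> u\<bar> \<le> K * (nrm u)\<^sup>2" "K \<ge> 0"
  shows "B u \<bullet> v \<le> 2 * K * nrm u * nrm v"
proof (cases "u = 0 \<or> v = 0")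
  case True
  then show ?thesis by (auto simp: linear_0[OF B] is_norm_zero[OF nrm])
next
  case False
  then have pos: "nrm u > 0" "nrm v > 0"
    using is_norm_nonneg[OF nrm, of u] is_norm_eq_0[OF nrm, of u]
      is_norm_nonneg[OF nrm, of v] is_norm_eq_0[OF nrm, of v] by force+
  define a b where "a = (1 / nrm u) *\<^sub>R u" and "b = (1 / nrm v) *\<^sub>R v"
  have ab: "nrm a = 1" "nrm b = 1" using pos by (auto simp: a_def b_def is_norm_scaleR[OF nrm])
  \<comment> \<open>Polarization: \<open>a + b\<close> and \<open>a - b\<close> both have norm at
    most 2, so each of the two quadratic forms contributes at most 4 K.\<close>
  have "4 * (B a \<bullet> b) = B (a + b) \<bullet> (a + b) - B (a - b) \<bullet> (a - b)"
    using sym[of a b] by (simp add: linear_add[OF B] linear_diff[OF B] algebra_simps)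
  also have "\<dots> \<le> K * (nrm (a + b))\<^sup>2 + K * (nrm (a - b))\<^sup>2"
    using K(1)[of "a + b"] K(1)[of "a - b"] by linarith
  also have "\<dots> \<le> K * 2\<^sup>2 + K * 2\<^sup>2"
    using is_norm_triangle[OF nrm, of a b] is_norm_diff[OF nrm, of a b] ab K(2)
    by (intro add_mono mult_left_mono power_mono) (auto intro: is_norm_nonneg[OF nrm])
  finally have "B a \<bullet> b \<le> 2 * K" by simp
  with pos show ?thesis
    by (simp add: a_def b_def linear_scale[OF B] field_simps)
qed

section \<open>Calculus along lines: optimality, convexity and symmetry of the Hessian\<close>

lemma has_real_derivative_along_line:
  fixes f :: "'a::real_normed_vector \<Rightarrow> real"
  assumes "(f has_derivative f') (at (z + t *\<^sub>R u))"
  shows "((\<lambda>s. f (z + s *\<^sub>R u)) has_real_derivative f' u) (at t)"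
proof -
  have "((\<lambda>s. f (z + s *\<^sub>R u)) has_derivative (\<lambda>h. f' (h *\<^sub>R u))) (at t)"
    by (rule has_derivative_compose[where f = "\<lambda>s. z + s *\<^sub>R u", OF _ assms])
      (auto intro!: derivative_eq_intros)
  moreover have "f' (h *\<^sub>R u) = h * f' u" for h
    using linear_scale[OF has_derivative_linear[OF assms]] by simp
  ultimately show ?thesis by (intro has_derivative_imp_has_field_derivative) auto
qed

lemma gradient_along_line:
  fixes G :: "'a::real_inner \<Rightarrow> 'a"
  assumes "(G has_derivative G') (at (z + t *\<^sub>R u))"
  shows "((\<lambda>s. G (z + s *\<^sub>R u) \<bullet> v) has_real_derivative G' u \<bullet> v) (at t)"
  using has_real_derivative_along_line[OF has_derivative_inner_left[OF assms]] .

text \<open>A linear lower bound to the right of 0 passes to the limit of difference quotients.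
  First-order optimality and positivity of the Hessian are both instances.\<close>

lemma derivative_at_0_ge:
  fixes q :: "real \<Rightarrow> real"
  assumes q: "(q has_real_derivative m) (at 0)"
    and le: "\<And>s. 0 < s \<Longrightarrow> s \<le> 1 \<Longrightarrow> q 0 + s * b \<le> q s"
  shows "b \<le> m"
proof (rule tendsto_lowerbound)
  show "((\<lambda>s. (q s - q 0) / s) \<longlongrightarrow> m) (at_right 0)"
    using q[unfolded has_field_derivative_iff] by (auto intro: tendsto_mono[OF at_le])
  have "\<forall>\<^sub>F s in at_right 0. s < (1::real) \<and> 0 < s"
    by (auto simp: eventually_at_right_field intro: exI[of _ 1])
  then show "\<forall>\<^sub>F s in at_right 0. b \<le> (q s - q 0) / s"
  proof eventually_elim
    case (elim s)
    with le[of s] show ?case by (simp add: field_simps)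
  qed
qed simp

text \<open>On the segment from \<open>p\<close> to \<open>y\<close>, convexity bounds the growth of
  \<open>psi\<close> by \<open>s * (psi y - psi p)\<close>; minimality forces \<open>S\<close> to
  make up for any decrease. Only \<open>psi\<close> has to be convex and only \<open>S\<close>
  differentiable.\<close>

lemma composite_minimizer_optimality:
  fixes S psi :: "'a::real_inner \<Rightarrow> real"
  assumes Q: "convex Q" and psi: "convex_on Q psi"
    and S: "(S has_derivative S') (at p)" and p: "p \<in> Q" and y: "y \<in> Q"
    and min: "\<And>z. z \<in> Q \<Longrightarrow> S p + psi p \<le> S z + psi z"
  shows "psi p - psi y \<le> S' (y - p)"
proof (rule derivative_at_0_ge)
  show "((\<lambda>s. S (p + s *\<^sub>R (y - p))) has_real_derivative S' (y - p)) (at 0)"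
    by (rule has_real_derivative_along_line) (use S in simp)
  fix s :: real assume s: "0 < s" "s \<le> 1"
  have z: "p + s *\<^sub>R (y - p) = (1 - s) *\<^sub>R p + s *\<^sub>R y" by (simp add: algebra_simps)
  have "psi (p + s *\<^sub>R (y - p)) \<le> (1 - s) * psi p + s * psi y"
    unfolding z using s p y by (intro convex_onD[OF psi]) auto
  moreover have "p + s *\<^sub>R (y - p) \<in> Q"
    unfolding z using s p y Q by (intro convexD) auto
  ultimately show "S (p + 0 *\<^sub>R (y - p)) + s * (psi p - psi y) \<le> S (p + s *\<^sub>R (y - p))"
    using min[of "p + s *\<^sub>R (y - p)"] by (simp add: algebra_simps)
qed

text \<open>For the smooth part \<open>- f\<close> and the convex part \<open>f\<close> the sum is
  constant, so every point is a minimizer and the optimality condition is the gradient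
  inequality.\<close>

lemma convex_on_above_gradient:
  fixes f :: "'a::real_inner \<Rightarrow> real"
  assumes "convex_on UNIV f" "(f has_derivative (\<lambda>h. g \<bullet> h)) (at x)"
  shows "f x + g \<bullet> (y - x) \<le> f y"
  using composite_minimizer_optimality[OF convex_UNIV assms(1) has_derivative_minus[OF assms(2)], of y]
  by simp

text \<open>Adding the gradient inequalities between two points shows that the gradient is monotone
  along \<open>u\<close>; differentiate this at \<open>z\<close>.\<close>

lemma convex_hessian_nonneg:
  fixes f :: "'a::real_inner \<Rightarrow> real"
  assumes cv: "convex_on UNIV f" and f: "\<And>z. (f has_derivative (\<lambda>h. gf z \<bullet> h)) (at z)"
    and gf: "(gf has_derivative B) (at z)"
  shows "0 \<le> B u \<bullet> u"
proof (rule derivative_at_0_ge)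
  show "((\<lambda>s. gf (z + s *\<^sub>R u) \<bullet> u) has_real_derivative B u \<bullet> u) (at 0)"
    by (rule gradient_along_line) (use gf in simp)
  fix s :: real assume s: "0 < s"
  have "s * (gf z \<bullet> u) \<le> s * (gf (z + s *\<^sub>R u) \<bullet> u)"
    using convex_on_above_gradient[OF cv f, of z "z + s *\<^sub>R u"]
      convex_on_above_gradient[OF cv f, of "z + s *\<^sub>R u" z] by simp
  with s show "gf (z + 0 *\<^sub>R u) \<bullet> u + s * 0 \<le> gf (z + s *\<^sub>R u) \<bullet> u" by simp
qed

text \<open>Differentiability of the gradient at the single point \<open>z\<close> suffices: the
  second difference is a difference of two gradients near \<open>z\<close>, and each is linearized
  at \<open>z\<close>.\<close>

lemma second_difference_approx:
  fixes f :: "'a::real_inner \<Rightarrow> real"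
  assumes f: "\<And>z. (f has_derivative (\<lambda>h. gf z \<bullet> h)) (at z)"
    and gf: "(gf has_derivative B) (at z)" and e: "e > 0"
  obtains d where "d > 0" "\<And>s. 0 < s \<Longrightarrow> s < d \<Longrightarrow>
    \<bar>f (z + s *\<^sub>R u + s *\<^sub>R v) - f (z + s *\<^sub>R u) - f (z + s *\<^sub>R v) + f z - s\<^sup>2 * (B u \<bullet> v)\<bar> \<le> e * s\<^sup>2"
proof -
  interpret B: bounded_linear B using gf by (rule has_derivative_bounded_linear)
  define C where "C = 1 + norm u + norm v"
  have C: "C > 0" "norm u < C" "norm v < C" unfolding C_def using norm_ge_zero[of u] norm_ge_zero[of v] by linarith+
  \<comment> \<open>Two linearization errors of size \<open>e' * (s * C)\<close>, tested against
    \<open>s *\<^sub>R v\<close> with \<open>norm v < C\<close>, then add up to at most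
    \<open>e * s\<^sup>2\<close>.\<close>
  define e' where "e' = e / (2 * C * C)"
  have e': "e' > 0" using e C by (simp add: e'_def)
  obtain d where d: "d > 0" "\<And>y. norm (y - z) < d \<Longrightarrow> norm (gf y - gf z - B (y - z)) \<le> e' * norm (y - z)"
    using gf e' unfolding has_derivative_at_alt by meson
  show ?thesis
  proof (rule that[of "d / C"])
    show "d / C > 0" using d C by simp
    fix s :: real assume s: "0 < s" "s < d / C"
    have sd: "s * C < d" using s C by (simp add: field_simps)
    \<comment> \<open>The second difference is the increment of \<open>?p\<close> from 0 to 1, which
      the mean value theorem turns into gradients.\<close>
    let ?p = "\<lambda>t. f ((z + s *\<^sub>R u) + t *\<^sub>R (s *\<^sub>R v)) - f (z + t *\<^sub>R (s *\<^sub>R v))"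
    let ?p' = "\<lambda>t. gf ((z + s *\<^sub>R u) + t *\<^sub>R (s *\<^sub>R v)) \<bullet> (s *\<^sub>R v) - gf (z + t *\<^sub>R (s *\<^sub>R v)) \<bullet> (s *\<^sub>R v)"
    have "(?p has_real_derivative ?p' t) (at t)" for t
      by (intro DERIV_diff has_real_derivative_along_line f)
    then obtain t where t: "0 < t" "t < 1" "?p 1 - ?p 0 = (1 - 0) * ?p' t"
      using MVT2[of 0 1 ?p ?p'] by auto
    let ?y1 = "z + s *\<^sub>R u + t *\<^sub>R (s *\<^sub>R v)" and ?y2 = "z + t *\<^sub>R (s *\<^sub>R v)"
    define E1 where "E1 = gf ?y1 - gf z - B (?y1 - z)"
    define E2 where "E2 = gf ?y2 - gf z - B (?y2 - z)"
    have tv: "t * norm v \<le> norm v" using t by (simp add: mult_left_le_one_le)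
    have "norm (?y1 - z) \<le> s * norm u + s * (t * norm v)"
      using norm_triangle_ineq[of "s *\<^sub>R u" "t *\<^sub>R (s *\<^sub>R v)"] s t by (simp add: mult_ac)
    also have "\<dots> \<le> s * norm u + s * norm v" using tv s by simp
    also have "\<dots> \<le> s * C" using s by (simp add: C_def algebra_simps)
    finally have n1: "norm (?y1 - z) \<le> s * C" .
    have "norm (?y2 - z) = s * (t * norm v)" using s t by simp
    also have "\<dots> \<le> s * C" using tv C s by (intro mult_left_mono) linarith+
    finally have n2: "norm (?y2 - z) \<le> s * C" .
    have E1: "norm E1 \<le> e' * (s * C)"
      using d(2)[of ?y1] n1 sd mult_left_mono[OF n1, of e'] e' unfolding E1_def by linarith
    have E2: "norm E2 \<le> e' * (s * C)"
      using d(2)[of ?y2] n2 sd mult_left_mono[OF n2, of e'] e' unfolding E2_def by linarith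
    have "gf ?y1 - gf ?y2 = s *\<^sub>R B u + (E1 - E2)"
      by (simp add: E1_def E2_def B.add B.scaleR)
    then have "(gf ?y1 - gf ?y2) \<bullet> (s *\<^sub>R v) - s\<^sup>2 * (B u \<bullet> v) = s * ((E1 - E2) \<bullet> v)"
      by (simp only: inner_add_left inner_scaleR_left inner_scaleR_right power2_eq_square ring_distribs)
    moreover have "f (z + s *\<^sub>R u + s *\<^sub>R v) - f (z + s *\<^sub>R u) - f (z + s *\<^sub>R v) + f z = (gf ?y1 - gf ?y2) \<bullet> (s *\<^sub>R v)"
      using t(3) by (simp add: inner_diff_left right_diff_distrib)
    moreover have "\<bar>s * ((E1 - E2) \<bullet> v)\<bar> \<le> e * s\<^sup>2"
    proof -
      have "\<bar>(E1 - E2) \<bullet> v\<bar> \<le> norm (E1 - E2) * norm v" by (rule Cauchy_Schwarz_ineq2)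
      also have "\<dots> \<le> (2 * (e' * (s * C))) * C"
        using E1 E2 norm_triangle_ineq4[of E1 E2] C s e' by (intro mult_mono) auto
      also have "\<dots> = e * s" using C by (simp add: e'_def)
      finally show ?thesis using s by (simp add: abs_mult power2_eq_square mult_left_mono)
    qed
    ultimately show "\<bar>f (z + s *\<^sub>R u + s *\<^sub>R v) - f (z + s *\<^sub>R u) - f (z + s *\<^sub>R v) + f z - s\<^sup>2 * (B u \<bullet> v)\<bar> \<le> e * s\<^sup>2"
      by simp
  qed
qed

text \<open>The second difference is unchanged when \<open>u\<close> and \<open>v\<close> are
  swapped, and it approximates both values up to o(s^2).\<close>

lemma hessian_symmetric:
  fixes f :: "'a::real_inner \<Rightarrow> real"
  assumes f: "\<And>z. (f has_derivative (\<lambda>h. gf z \<bullet> h)) (at z)"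
    and gf: "(gf has_derivative B) (at z)"
  shows "B u \<bullet> v = B v \<bullet> u"
proof (rule ccontr)
  assume ne: "B u \<bullet> v \<noteq> B v \<bullet> u"
  \<comment> \<open>With a quarter of the discrepancy, the two errors together explain only half of
    it.\<close>
  define e where "e = \<bar>B u \<bullet> v - B v \<bullet> u\<bar> / 4"
  have e: "e > 0" using ne by (simp add: e_def)
  let ?D = "\<lambda>s u v. f (z + s *\<^sub>R u + s *\<^sub>R v) - f (z + s *\<^sub>R u) - f (z + s *\<^sub>R v) + f z"
  obtain d1 where d1: "d1 > 0"
    "\<And>s. 0 < s \<Longrightarrow> s < d1 \<Longrightarrow> \<bar>?D s u v - s\<^sup>2 * (B u \<bullet> v)\<bar> \<le> e * s\<^sup>2"
    using second_difference_approx[OF f gf e] by blast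
  obtain d2 where d2: "d2 > 0"
    "\<And>s. 0 < s \<Longrightarrow> s < d2 \<Longrightarrow> \<bar>?D s v u - s\<^sup>2 * (B v \<bullet> u)\<bar> \<le> e * s\<^sup>2"
    using second_difference_approx[OF f gf e] by blast
  define s where "s = min d1 d2 / 2"
  have s: "0 < s" "s < d1" "s < d2" using d1(1) d2(1) by (auto simp: s_def)
  have "?D s u v = ?D s v u" by (simp add: algebra_simps)
  then have "\<bar>s\<^sup>2 * (B u \<bullet> v) - s\<^sup>2 * (B v \<bullet> u)\<bar> \<le> 2 * (e * s\<^sup>2)"
    using d1(2)[OF s(1,2)] d2(2)[OF s(1,3)] by linarith
  then have "s\<^sup>2 * (4 * e) \<le> s\<^sup>2 * (2 * e)"
    by (simp add: e_def abs_mult flip: right_diff_distrib)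
  with s e show False by simp
qed

section \<open>Taylor estimates under a Lipschitz Hessian\<close>

lemma has_real_derivative_mono_diff:
  fixes p q :: "real \<Rightarrow> real"
  assumes "a \<le> b" "\<And>t. a \<le> t \<Longrightarrow> t \<le> b \<Longrightarrow> (p has_real_derivative p' t) (at t)"
    "\<And>t. a \<le> t \<Longrightarrow> t \<le> b \<Longrightarrow> (q has_real_derivative q' t) (at t)"
    "\<And>t. a \<le> t \<Longrightarrow> t \<le> b \<Longrightarrow> p' t \<le> q' t"
  shows "p b - p a \<le> q b - q a"
proof -
  have "p b - q b \<le> p a - q a"
  proof (rule DERIV_nonpos_imp_nonincreasing[OF assms(1)])
    fix t assume t: "a \<le> t" "t \<le> b"
    show "\<exists>y. ((\<lambda>t. p t - q t) has_real_derivative y) (at t) \<and> y \<le> 0"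
      using DERIV_diff[OF assms(2,3)[OF t]] assms(4)[OF t] by auto
  qed
  then show ?thesis by linarith
qed

text \<open>Integrating the bound \<open>t * K\<close> over the segment gives \<open>K / 2\<close>.
  The test vector \<open>v\<close> is free, so that the bilinear bound (any \<open>v\<close>) and
  the sharper quadratic one (\<open>v = u\<close>) can both be inserted.\<close>

lemma gradient_taylor_bound:
  fixes G :: "'a::real_inner \<Rightarrow> 'a"
  assumes G: "\<And>z. (G has_derivative G' z) (at z)"
    and le: "\<And>t. 0 \<le> t \<Longrightarrow> t \<le> 1 \<Longrightarrow> (G' (x + t *\<^sub>R u) u - G' x u) \<bullet> v \<le> t * K"
  shows "(G (x + u) - G x - G' x u) \<bullet> v \<le> K / 2"
proof -
  have "(G (x + 1 *\<^sub>R u) \<bullet> v - 1 * (G' x u \<bullet> v)) - (G (x + 0 *\<^sub>R u) \<bullet> v - 0 * (G' x u \<bullet> v))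
      \<le> K / 2 * 1\<^sup>2 - K / 2 * 0\<^sup>2"
  proof (rule has_real_derivative_mono_diff)
    fix t :: real assume t: "0 \<le> t" "t \<le> 1"
    show "((\<lambda>t. G (x + t *\<^sub>R u) \<bullet> v - t * (G' x u \<bullet> v)) has_real_derivative
        G' (x + t *\<^sub>R u) u \<bullet> v - G' x u \<bullet> v) (at t)"
      by (intro DERIV_diff gradient_along_line G) (auto intro!: derivative_eq_intros)
    show "((\<lambda>t. K / 2 * t\<^sup>2) has_real_derivative t * K) (at t)"
      by (auto intro!: derivative_eq_intros)
    show "G' (x + t *\<^sub>R u) u \<bullet> v - G' x u \<bullet> v \<le> t * K"
      using le[OF t] by (simp add: inner_diff_left)
  qed simp
  then show ?thesis by (simp add: inner_diff_left)
qed

context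
  fixes nrm f :: "'a::euclidean_space \<Rightarrow> real" and gf :: "'a \<Rightarrow> 'a" and Hf :: "'a \<Rightarrow> 'a \<Rightarrow> 'a"
    and Q :: "'a set" and L2 :: real
  assumes nrm: "is_norm nrm"
    and Q: "convex Q"
    and f: "\<And>z. (f has_derivative (\<lambda>h. gf z \<bullet> h)) (at z)"
    and gf: "\<And>z. (gf has_derivative Hf z) (at z)"
    and L2: "L2 \<ge> 0"
    and lip: "\<forall>u\<in>Q. \<forall>v\<in>Q. op_norm nrm (\<lambda>h. Hf u h - Hf v h) \<le> L2 * nrm (u - v)"
begin

lemma hessian_diff_quadratic_le:
  assumes "x \<in> Q" "y \<in> Q"
  shows "\<bar>(Hf x h - Hf y h) \<bullet> h\<bar> \<le> L2 * nrm (x - y) * (nrm h)\<^sup>2"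
proof -
  have "bounded_linear (\<lambda>h. Hf x h - Hf y h)"
    by (intro bounded_linear_sub has_derivative_bounded_linear[OF gf])
  from quadratic_form_le_op_norm[OF nrm this, of h] show ?thesis
    using mult_right_mono[OF lip[rule_format, OF assms], of "(nrm h)\<^sup>2"] by simp
qed

lemma hessian_diff_bilinear_le:
  assumes "x \<in> Q" "y \<in> Q"
  shows "(Hf x u - Hf y u) \<bullet> v \<le> 2 * (L2 * nrm (x - y)) * nrm u * nrm v"
proof (rule bilinear_le_two_quadratic[OF nrm, where B = "\<lambda>h. Hf x h - Hf y h"])
  show "linear (\<lambda>h. Hf x h - Hf y h)"
    by (intro linear_compose_sub has_derivative_linear[OF gf])
  show "(Hf x u - Hf y u) \<bullet> v = (Hf x v - Hf y v) \<bullet> u" for u v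
    using hessian_symmetric[OF f gf, of x u v] hessian_symmetric[OF f gf, of y u v]
    by (simp add: inner_diff_left)
qed (use hessian_diff_quadratic_le[OF assms] L2 in \<open>auto intro!: mult_nonneg_nonneg is_norm_nonneg[OF nrm]\<close>)

lemma segment_in_domain:
  assumes "x \<in> Q" "x + u \<in> Q" "0 \<le> t" "t \<le> 1"
  shows "x + t *\<^sub>R u \<in> Q"
proof -
  have "x + t *\<^sub>R u = (1 - t) *\<^sub>R x + t *\<^sub>R (x + u)" by (simp add: algebra_simps)
  then show ?thesis using convexD[OF Q assms(1,2), of "1 - t" t] assms(3,4) by simp
qed

text \<open>The factor 2 lost in polarization cancels the 1/2 gained by integration.\<close>

lemma gradient_residual_dual_norm_le:
  assumes "x \<in> Q" "x + u \<in> Q"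
  shows "dual_norm nrm (gf (x + u) - gf x - Hf x u) \<le> L2 * (nrm u)\<^sup>2"
proof (rule dual_norm_leI[OF nrm])
  fix v assume v: "nrm v \<le> 1"
  have "(gf (x + u) - gf x - Hf x u) \<bullet> v \<le> 2 * L2 * (nrm u)\<^sup>2 * nrm v / 2"
  proof (rule gradient_taylor_bound[OF gf])
    fix t :: real assume t: "0 \<le> t" "t \<le> 1"
    show "(Hf (x + t *\<^sub>R u) u - Hf x u) \<bullet> v \<le> t * (2 * L2 * (nrm u)\<^sup>2 * nrm v)"
      using hessian_diff_bilinear_le[OF segment_in_domain[OF assms t] assms(1), of u v] t
      by (simp add: is_norm_scaleR[OF nrm] power2_eq_square mult_ac)
  qed
  also have "\<dots> \<le> L2 * (nrm u)\<^sup>2"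
    using mult_left_mono[OF v, of "L2 * (nrm u)\<^sup>2"] L2 by simp
  finally show "(gf (x + u) - gf x - Hf x u) \<bullet> v \<le> L2 * (nrm u)\<^sup>2" .
qed

lemma gradient_residual_inner_le:
  assumes "x \<in> Q" "x + u \<in> Q"
  shows "(gf (x + u) - gf x - Hf x u) \<bullet> u \<le> L2 * nrm u ^ 3 / 2"
proof (rule gradient_taylor_bound[OF gf])
  fix t :: real assume t: "0 \<le> t" "t \<le> 1"
  show "(Hf (x + t *\<^sub>R u) u - Hf x u) \<bullet> u \<le> t * (L2 * nrm u ^ 3)"
    using hessian_diff_quadratic_le[OF segment_in_domain[OF assms t] assms(1), of u] t
    by (simp add: is_norm_scaleR[OF nrm] power2_eq_square power3_eq_cube mult_ac)
qed

lemma function_taylor_bound: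
  assumes "x \<in> Q" "x + u \<in> Q"
  shows "f (x + u) \<le> f x + gf x \<bullet> u + 1/2 * (Hf x u \<bullet> u) + L2 * nrm u ^ 3 / 6"
proof -
  have "f (x + 1 *\<^sub>R u) - f (x + 0 *\<^sub>R u) \<le>
      (1 * (gf x \<bullet> u) + 1\<^sup>2 / 2 * (Hf x u \<bullet> u) + L2 * nrm u ^ 3 / 6 * 1 ^ 3)
      - (0 * (gf x \<bullet> u) + 0\<^sup>2 / 2 * (Hf x u \<bullet> u) + L2 * nrm u ^ 3 / 6 * 0 ^ 3)"
  proof (rule has_real_derivative_mono_diff)
    fix t :: real assume t: "0 \<le> t" "t \<le> 1"
    show "((\<lambda>t. f (x + t *\<^sub>R u)) has_real_derivative gf (x + t *\<^sub>R u) \<bullet> u) (at t)"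
      by (intro has_real_derivative_along_line f)
    show "((\<lambda>t. t * (gf x \<bullet> u) + t\<^sup>2 / 2 * (Hf x u \<bullet> u) + L2 * nrm u ^ 3 / 6 * t ^ 3) has_real_derivative
        gf x \<bullet> u + t * (Hf x u \<bullet> u) + L2 * nrm u ^ 3 / 2 * t\<^sup>2) (at t)"
      by (auto intro!: derivative_eq_intros)
    show "gf (x + t *\<^sub>R u) \<bullet> u \<le> gf x \<bullet> u + t * (Hf x u \<bullet> u) + L2 * nrm u ^ 3 / 2 * t\<^sup>2"
    proof (cases "t = 0")
      case False
      with t have "t > 0" by simp
      \<comment> \<open>The residual bound for the shortened step \<open>t *\<^sub>R u\<close>
        carries an extra factor \<open>t\<close>, which is cancelled; hence the separate case
        \<open>t = 0\<close>.\<close>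
      have "(gf (x + t *\<^sub>R u) - gf x - Hf x (t *\<^sub>R u)) \<bullet> (t *\<^sub>R u) \<le> L2 * nrm (t *\<^sub>R u) ^ 3 / 2"
        by (rule gradient_residual_inner_le[OF assms(1) segment_in_domain[OF assms t]])
      then have "t * ((gf (x + t *\<^sub>R u) - gf x - t *\<^sub>R Hf x u) \<bullet> u) \<le> t * (L2 * nrm u ^ 3 / 2 * t\<^sup>2)"
        using \<open>t > 0\<close> linear_scale[OF has_derivative_linear[OF gf]]
        by (simp add: is_norm_scaleR[OF nrm] power_mult_distrib power2_eq_square power3_eq_cube mult_ac)
      then have "(gf (x + t *\<^sub>R u) - gf x - t *\<^sub>R Hf x u) \<bullet> u \<le> L2 * nrm u ^ 3 / 2 * t\<^sup>2"
        using \<open>t > 0\<close> by (simp only: mult_le_cancel_left_pos)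
      then show ?thesis by (simp add: inner_diff_left)
    qed simp
  qed simp
  then show ?thesis by simp
qed

end

section \<open>Scalar inequalities: progress of one step and the potential\<close>

lemma step_polynomial_ineq:
  fixes kap lam t :: real
  assumes "kap \<ge> 1" "0 \<le> lam" "lam \<le> 1" "0 \<le> t" "t \<le> 1"
  shows "3/2 * (kap * t + 3 * lam * t\<^sup>2) - 1/2 \<le> 2 * (kap + 3 * lam / 2)\<^sup>2 * (t\<^sup>2 - lam * t ^ 3 / 2)"
proof -
  \<comment> \<open>In these variables the right-hand side is \<open>y\<^sup>2 * (2 - m)\<close> and
    the bound on the gradient ratio is \<open>y + 3 * m * (t - 1/2)\<close>. The sign of
    \<open>t - 1/2\<close> decides the case split.\<close>
  define m y where "m = lam * t" and "y = kap * t + 3/2 * m"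
  have m: "0 \<le> m" "m \<le> t" using assms by (auto simp: m_def mult_left_le_one_le)
  have y: "t + 3/2 * m \<le> y" using assms mult_right_mono[of 1 kap t] by (simp add: y_def)
  have "0 \<le> y\<^sup>2 * (2 - m) - 3/2 * (y + 3 * m * (t - 1/2)) + 1/2"
  proof (cases "t \<le> 1/2")
    case True
    have "0 \<le> y\<^sup>2 * (2 - 1/2) - 3/2 * y + 1/2"
      using zero_le_power2[of "y - 1/2"] by (simp add: power2_eq_square algebra_simps)
    moreover have "y\<^sup>2 * (2 - 1/2) \<le> y\<^sup>2 * (2 - m)" using m True by (intro mult_left_mono) auto
    moreover have "3 * m * (t - 1/2) \<le> 0" using m True by (intro mult_nonneg_nonpos) auto
    ultimately show ?thesis by argo
  next
    case False
    \<comment> \<open>\<open>w\<close> is the value of \<open>y\<close> at \<open>kap = 1\<close>.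
      From \<open>w\<close> on the expression is nondecreasing in \<open>y\<close>, because
      \<open>2 * w * (2 - m) \<ge> 3/2\<close>, which reduces the claim to
      \<open>kap = 1\<close>.\<close>
    define w where "w = t + 3/2 * m"
    have w: "1/2 \<le> w" "w \<le> y" "3/2 \<le> 2 * w * (2 - m)"
    proof -
      show "1/2 \<le> w" "w \<le> y" using False m y by (auto simp: w_def)
      have "m * m \<le> m * 1" "1/2 * (2 - m) \<le> t * (2 - m)" using False m assms(5) by (intro mult_mono, auto)+
      then show "3/2 \<le> 2 * w * (2 - m)"
        using m by (simp add: w_def field_simps)
    qed
    have "y\<^sup>2 * (2 - m) - 3/2 * y - (w\<^sup>2 * (2 - m) - 3/2 * w) = (y - w) * ((y + w) * (2 - m) - 3/2)"
      by (simp add: power2_eq_square field_simps)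
    moreover have "0 \<le> (y - w) * ((y + w) * (2 - m) - 3/2)"
    proof (intro mult_nonneg_nonneg)
      have "2 * w * (2 - m) \<le> (y + w) * (2 - m)" using w m assms(5) by (intro mult_right_mono) auto
      then show "0 \<le> (y + w) * (2 - m) - 3/2" using w by linarith
    qed (use w in simp)
    moreover have "0 \<le> w\<^sup>2 * (2 - m) - 3/2 * w - 9/2 * m * (t - 1/2) + 1/2"
    proof -
      have eq: "w\<^sup>2 * (2 - m) - 3/2 * w - 9/2 * m * (t - 1/2) + 1/2
        = (2 * t\<^sup>2 - 3/2 * t + 1/2) + 3/2 * (m * t) + 9/2 * m\<^sup>2 - m * t * t - 3 * (m\<^sup>2 * t) - 9/4 * (m\<^sup>2 * m)"
        by (simp add: w_def power2_eq_square field_simps)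
      \<comment> \<open>Using \<open>t \<le> 1\<close> and \<open>m \<le> 1\<close> in the negative
        terms leaves m t / 2 - 3 m^2 / 4, which is at least - t^2 / 4 as \<open>m \<le> t\<close>.
        This lowers the coefficient 2 to 7/4; the remaining quadratic has its minimum, a positive
        one, at 3/7.\<close>
      have "m * t * t \<le> m * t * 1" "m\<^sup>2 * t \<le> m\<^sup>2 * 1" "m\<^sup>2 * m \<le> m\<^sup>2 * 1" "m * m \<le> m * t" "m * m \<le> t * t"
        using m assms(4,5) by (intro mult_mono; simp)+
      moreover have "0 \<le> 7/4 * t\<^sup>2 - 3/2 * t + 1/2"
        using zero_le_power2[of "t - 3/7"] by (simp add: power2_eq_square algebra_simps)
      ultimately show ?thesis unfolding eq by (simp add: power2_eq_square)
    qed
    ultimately show ?thesis by argo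
  qed
  moreover have "y\<^sup>2 * (2 - m) = 2 * (kap + 3 * lam / 2)\<^sup>2 * (t\<^sup>2 - lam * t ^ 3 / 2)"
    by (simp add: y_def m_def power2_eq_square power3_eq_cube field_simps)
  moreover have "y + 3 * m * (t - 1/2) = kap * t + 3 * lam * t\<^sup>2"
    by (simp add: y_def m_def power2_eq_square field_simps)
  ultimately show ?thesis by argo
qed

text \<open>\<open>potential y\<close> is the time the flow \<open>y' = - (max 1 y) powr (3/2)\<close> needs to
  reach 0.\<close>

definition potential :: "real \<Rightarrow> real" where
  "potential y = (if y \<le> 1 then y else 3 - 2 / sqrt y)"

lemma potential_nonneg: "0 \<le> y \<Longrightarrow> 0 \<le> potential y"
proof -
  assume "0 \<le> y"
  moreover have "2 / sqrt y \<le> 2 / 1" if "y > 1"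
    using that by (intro divide_left_mono) auto
  ultimately show ?thesis by (auto simp: potential_def)
qed

lemma potential_le: "potential y \<le> 3"
  by (auto simp: potential_def)

text \<open>\<open>potential\<close> is concave with slope \<open>(max 1 y) powr (-3/2)\<close>, so
  its drop from \<open>y\<close> to \<open>z\<close> is at least the slope at \<open>y\<close> times
  \<open>y - z\<close>; a larger \<open>gam\<close> only weakens this.\<close>

lemma potential_decrease:
  assumes z: "0 \<le> z" "z \<le> y" and gam: "1 \<le> gam" "y \<le> gam"
  shows "(y - z) / (gam * sqrt gam) \<le> potential y - potential z"
proof -
  have *: "(y - z) / (gam * sqrt gam) \<le> (y - z) / (q * sqrt q)" if "0 < q" "q \<le> gam" for q
    using that z by (intro divide_left_mono mult_mono) auto
  show ?thesis
  proof (cases "y \<le> 1")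
    case True
    then show ?thesis using *[of 1] gam z by (simp add: potential_def)
  next
    case False
    define a where "a = sqrt y"
    have a: "a > 1" "y = a\<^sup>2" using False by (auto simp: a_def)
    have pot_y: "potential y = 3 - 2 / a" using False by (simp add: potential_def a_def)
    have "(y - z) / (gam * sqrt gam) \<le> (a\<^sup>2 - z) / (a\<^sup>2 * a)"
      using *[of y] False gam by (simp add: a_def)
    also have "\<dots> \<le> potential y - potential z"
    proof (cases "z \<le> 1")
      case True
      \<comment> \<open>This is the claim at \<open>z = 1\<close>. Smaller \<open>z\<close> follow
        because the cleared inequality reads z (a^3 - 1) <= 3 a^3 - 3 a^2 with
        \<open>a > 1\<close>.\<close>
      have "0 \<le> (a - 1)\<^sup>2 * (2 * a + 1)" using a by simp
      then have "0 \<le> 2 * a ^ 3 - 3 * a\<^sup>2 + 1"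
        by (simp add: power2_eq_square power3_eq_cube algebra_simps)
      moreover have "z * (a ^ 3 - 1) \<le> 1 * (a ^ 3 - 1)"
        using True a by (intro mult_right_mono) auto
      moreover have "(3 - 2 / a - z) * (a\<^sup>2 * a) = 3 * a ^ 3 - 2 * a\<^sup>2 - z * a ^ 3"
        using a(1) by (simp add: power2_eq_square power3_eq_cube field_simps)
      ultimately have "a\<^sup>2 - z \<le> (3 - 2 / a - z) * (a\<^sup>2 * a)"
        by (simp add: right_diff_distrib)
      then have "(a\<^sup>2 - z) / (a\<^sup>2 * a) \<le> 3 - 2 / a - z" using a(1) by (simp add: pos_divide_le_eq)
      moreover have "potential z = z" using True by (simp add: potential_def)
      ultimately show ?thesis using pot_y by simp
    next
      case zz: False
      define b where "b = sqrt z"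
      have b: "b > 1" "z = b\<^sup>2" "b \<le> a" using zz z by (auto simp: a_def b_def)
      \<comment> \<open>After cancelling \<open>a - b\<close> and clearing denominators, exactly b
        (a + b) <= 2 a^2 remains.\<close>
      have "b * (a + b) \<le> a * (a + a)" using b a by (intro mult_mono) auto
      then have "(a - b) * (b * (a + b)) \<le> (a - b) * (a * (a + a))" using b by (intro mult_left_mono) auto
      then have "(a - b) * (b * (a + b)) / (a * a * a * b) \<le> (a - b) * (a * (a + a)) / (a * a * a * b)"
        using a(1) b(1) by (intro divide_right_mono) auto
      moreover have "(a\<^sup>2 - b\<^sup>2) / (a\<^sup>2 * a) = (a - b) * (b * (a + b)) / (a * a * a * b)"
        "2 / b - 2 / a = (a - b) * (a * (a + a)) / (a * a * a * b)"
        using a(1) b(1) by (simp_all add: power2_eq_square field_simps)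
      ultimately have "(a\<^sup>2 - b\<^sup>2) / (a\<^sup>2 * a) \<le> 2 / b - 2 / a" by simp
      moreover have "potential z = 3 - 2 / b" using zz by (simp add: potential_def b_def)
      ultimately show ?thesis using pot_y b(2) by simp
    qed
    finally show ?thesis .
  qed
qed

section \<open>Estimates for one step of the method\<close>

lemma newton_step:
  fixes nrm f d psi :: "'a::euclidean_space \<Rightarrow> real" and A sigma :: real
  assumes nrm: "is_norm nrm"
    and Q: "convex Q" and psi: "convex_on Q psi"
    and f_conv: "convex_on UNIV f"
    and f: "\<And>z. (f has_derivative (\<lambda>h. gf z \<bullet> h)) (at z)"
    and gf: "\<And>z. (gf has_derivative Hf z) (at z)"
    and L2: "L2 \<ge> 0"
    and lip: "\<forall>u\<in>Q. \<forall>v\<in>Q. op_norm nrm (\<lambda>h. Hf u h - Hf v h) \<le> L2 * nrm (u - v)"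
    and d: "\<And>z. (d has_derivative (\<lambda>h. gd z \<bullet> h)) (at z)"
    and d_sc: "\<forall>u\<in>Q. \<forall>v\<in>Q. d v \<ge> d u + gd u \<bullet> (v - u) + sigma / 2 * (nrm (v - u))\<^sup>2"
    and d_lip: "\<forall>u\<in>Q. \<forall>v\<in>Q. dual_norm nrm (gd u - gd v) \<le> nrm (u - v)"
    and A: "A \<ge> 0" and x: "x \<in> Q" and T: "is_T Q f gf Hf d gd psi A x y"
    and p: "p - gf x \<in> subgrad Q psi x"
    and p': "p' = gf y - gf x - Hf x (y - x) - A *\<^sub>R (gd y - gd x)"
  defines "r \<equiv> nrm (y - x)"
  shows "y \<in> Q"
    and "p' - gf y \<in> subgrad Q psi y"
    and "A * sigma * r \<le> dual_norm nrm p"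
    and "dual_norm nrm p' \<le> A * r + L2 * r\<^sup>2"
    and "A * sigma * r\<^sup>2 - L2 * r ^ 3 / 6 \<le> f x + psi x - (f y + psi y)"
proof -
  have r0: "0 \<le> r" by (simp add: r_def is_norm_nonneg[OF nrm])
  show y: "y \<in> Q" using T by (simp add: is_T_def)
  \<comment> \<open>\<open>?S\<close> is the differentiable part of the model; by symmetry of the
    Hessian its gradient at \<open>y\<close> is \<open>gf y - p'\<close>.\<close>
  let ?S = "\<lambda>z. f x + gf x \<bullet> (z - x) + 1/2 * (Hf x (z - x) \<bullet> (z - x)) + A * bregman d gd x z"
  have "bounded_linear (Hf x)" by (rule has_derivative_bounded_linear[OF gf])
  then have "(?S has_derivative (\<lambda>h. gf x \<bullet> h + 1/2 * (Hf x (y - x) \<bullet> h + Hf x h \<bullet> (y - x))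
      + A * (gd y \<bullet> h - gd x \<bullet> h))) (at y)"
    unfolding bregman_def
    by (auto intro!: derivative_eq_intros d bounded_linear.has_derivative[of "Hf x"])
  moreover have "gf x \<bullet> h + 1/2 * (Hf x (y - x) \<bullet> h + Hf x h \<bullet> (y - x)) + A * (gd y \<bullet> h - gd x \<bullet> h)
      = (gf y - p') \<bullet> h" for h
    using hessian_symmetric[OF f gf, of x h "y - x"]
    by (simp add: p' inner_diff_left inner_add_left)
  ultimately have S: "(?S has_derivative (\<lambda>h. (gf y - p') \<bullet> h)) (at y)" by simp
  have opt: "psi y - psi z \<le> (gf y - p') \<bullet> (z - y)" if "z \<in> Q" for z
    by (rule composite_minimizer_optimality[OF Q psi S y that])
      (use T in \<open>auto simp: is_T_def newton_model_def\<close>)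
  then show "p' - gf y \<in> subgrad Q psi y"
    unfolding subgrad_def by (fastforce simp: inner_diff_left)
  have hess: "0 \<le> Hf x (y - x) \<bullet> (y - x)" by (rule convex_hessian_nonneg[OF f_conv f gf])
  \<comment> \<open>Adding strong convexity from \<open>x\<close> to \<open>y\<close> and from
    \<open>y\<close> to \<open>x\<close> doubles \<open>sigma / 2\<close>.\<close>
  have "sigma * r\<^sup>2 \<le> (gd y - gd x) \<bullet> (y - x)"
    using d_sc[rule_format, OF x y] d_sc[rule_format, OF y x] is_norm_minus_commute[OF nrm, of x y]
    by (simp add: r_def inner_diff_left inner_diff_right)
  from mult_left_mono[OF this A] have breg: "A * sigma * r\<^sup>2 \<le> A * ((gd y - gd x) \<bullet> (y - x))"
    by simp
  have descent: "psi y - psi x \<le> - (gf x \<bullet> (y - x)) - Hf x (y - x) \<bullet> (y - x) - A * ((gd y - gd x) \<bullet> (y - x))"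
    using opt[OF x] by (simp add: p' inner_diff_left inner_diff_right inner_add_left algebra_simps)
  \<comment> \<open>Against the optimality condition tested at \<open>x\<close>, the terms with
    \<open>gf x\<close> cancel. A subgradient of \<open>psi\<close> is used, not of
    \<open>f + psi\<close>: the latter would bring in \<open>f y - f x\<close>, which may exceed its
    linearization at \<open>x\<close>.\<close>
  have "psi x + (p - gf x) \<bullet> (y - x) \<le> psi y" using p y by (simp add: subgrad_def)
  then have "A * sigma * r\<^sup>2 \<le> p \<bullet> (x - y)"
    using descent breg hess by (simp add: inner_diff_left inner_diff_right)
  also have "\<dots> \<le> dual_norm nrm p * r"
    using inner_le_dual_norm[OF nrm, of p "x - y"] is_norm_minus_commute[OF nrm, of x y] by (simp add: r_def)
  finally have "r * (A * sigma * r) \<le> r * dual_norm nrm p" by (simp add: power2_eq_square mult_ac)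
  then show "A * sigma * r \<le> dual_norm nrm p"
    using r0 dual_norm_nonneg[OF nrm, of p] by (cases "r = 0") auto
  have "dual_norm nrm p' \<le> dual_norm nrm (gf y - gf x - Hf x (y - x)) + A * dual_norm nrm (gd y - gd x)"
    unfolding p' by (rule dual_norm_diff_scaleR_le[OF nrm A])
  also have "\<dots> \<le> L2 * r\<^sup>2 + A * r"
    using gradient_residual_dual_norm_le[OF nrm Q f gf L2 lip x, of "y - x"] y
      mult_left_mono[OF d_lip[rule_format, OF y x] A]
    by (simp add: r_def)
  finally show "dual_norm nrm p' \<le> A * r + L2 * r\<^sup>2" by simp
  \<comment> \<open>The model contains half the Hessian form while \<open>descent\<close> subtracts
    all of it, so a nonpositive half is left and dropped.\<close>
  have "f y \<le> f x + gf x \<bullet> (y - x) + 1/2 * (Hf x (y - x) \<bullet> (y - x)) + L2 * r ^ 3 / 6"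
    using function_taylor_bound[OF nrm Q f gf L2 lip x, of "y - x"] y by (simp add: r_def)
  then show "A * sigma * r\<^sup>2 - L2 * r ^ 3 / 6 \<le> f x + psi x - (f y + psi y)"
    using descent breg hess by linarith
qed

text \<open>As \<open>S * S = H / 3 * g\<close>, the step length enters only through
  \<open>t\<close>: the term \<open>L2 * r\<^sup>2 / g\<close> becomes
  \<open>3 * lam * t\<^sup>2\<close>, and the decrease divided by \<open>g\<^sup>2 / S\<close>
  becomes the cubic of \<open>step_polynomial_ineq\<close>.\<close>

lemma scalar_step:
  fixes g g' r H L2 sigma Delta :: real
  assumes H: "H > 0" "0 \<le> L2" "L2 \<le> H" and sigma: "0 < sigma" "sigma \<le> 1"
    and g: "0 < g" "0 < g'" and r: "0 \<le> r"
    and S: "S = sqrt (H / 3 * g)"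
    and small: "S * r \<le> g"
    and grow: "g' \<le> S / sigma * r + L2 * r\<^sup>2"
    and decr: "S * r\<^sup>2 - L2 * r ^ 3 / 6 \<le> Delta"
  shows "1 + 3/2 * ln (g' / g) \<le> 2 * (1 / sigma + 3 * L2 / (2 * H))\<^sup>2 * (S * Delta / g\<^sup>2)"
proof -
  define t where "t = S * r / g"
  define lam where "lam = L2 / H"
  let ?c = "1 / sigma + 3 * lam / 2"
  have S2: "S * S = H / 3 * g" and S0: "S > 0" using S H g by auto
  have t: "0 \<le> t" "t \<le> 1" using r S0 g small by (auto simp: t_def)
  have lam: "0 \<le> lam" "lam \<le> 1" using H by (auto simp: lam_def)
  have t2: "t\<^sup>2 = H / 3 * r\<^sup>2 / g"
    using S2 g by (simp add: t_def power2_eq_square field_simps)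
  have "1 / sigma * t + 3 * lam * t\<^sup>2 = (S / sigma * r + L2 * r\<^sup>2) / g"
    unfolding t2 using H g by (simp add: t_def lam_def add_divide_distrib)
  then have th: "g' / g \<le> 1 / sigma * t + 3 * lam * t\<^sup>2"
    using grow g by (simp add: divide_right_mono)
  \<comment> \<open>Replacing the logarithm by its tangent at 1 turns \<open>1 + 3/2 * ln q\<close>
    into \<open>3/2 * q - 1/2\<close>.\<close>
  have "ln (g' / g) \<le> g' / g - 1" using g by (intro ln_le_minus_one) simp
  then have "1 + 3/2 * ln (g' / g) \<le> 3/2 * (1 / sigma * t + 3 * lam * t\<^sup>2) - 1/2" using th by argo
  also have "\<dots> \<le> 2 * ?c\<^sup>2 * (t\<^sup>2 - lam * t ^ 3 / 2)"
    using sigma by (intro step_polynomial_ineq lam t) simp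
  also have "t\<^sup>2 - lam * t ^ 3 / 2 = S * (S * r\<^sup>2 - L2 * r ^ 3 / 6) / g\<^sup>2"
  proof -
    have "lam * t ^ 3 / 2 = lam * t\<^sup>2 * t / 2" by (simp add: power2_eq_square power3_eq_cube)
    also have "\<dots> = S * (L2 * r ^ 3 / 6) / g\<^sup>2"
      unfolding t2 using H g by (simp add: t_def lam_def power2_eq_square power3_eq_cube)
    finally show ?thesis by (simp add: t_def power2_eq_square right_diff_distrib diff_divide_distrib mult_ac)
  qed
  also have "2 * ?c\<^sup>2 * (S * (S * r\<^sup>2 - L2 * r ^ 3 / 6) / g\<^sup>2) \<le> 2 * ?c\<^sup>2 * (S * Delta / g\<^sup>2)"
    using decr S0 by (intro mult_left_mono divide_right_mono) auto
  also have "?c = 1 / sigma + 3 * L2 / (2 * H)" by (simp add: lam_def mult.commute)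
  finally show ?thesis .
qed

text \<open>The left factor scales like \<open>g powr (-3/2)\<close>, which is the slope of the
  potential after measuring gaps in units of \<open>D * delta\<close> and taking
  \<open>gam = g / delta\<close>. Then \<open>a \<le> g * D\<close> says \<open>y \<le> gam\<close>,
  and \<open>delta \<le> g\<close> says \<open>gam \<ge> 1\<close>.\<close>

lemma potential_step:
  fixes g H D delta a b :: real
  assumes H: "H > 0" and delta: "0 < delta" "delta \<le> g" and D: "D \<ge> 0"
    and ab: "0 \<le> b" "b \<le> a" "a \<le> g * D"
  shows "sqrt (H / 3 * g) * (a - b) / g\<^sup>2
    \<le> sqrt (H / 3) * D / sqrt delta * (potential (a / (D * delta)) - potential (b / (D * delta)))"
proof (cases "D = 0")
  case True
  then have "a - b = 0" using ab by auto
  then show ?thesis using True by simp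
next
  case False
  with D have D: "D > 0" by simp
  have g: "g > 0" using delta by simp
  let ?gam = "g / delta"
  have "sqrt (H / 3) * D / sqrt delta * ((a / (D * delta) - b / (D * delta)) / (?gam * sqrt ?gam))
    \<le> sqrt (H / 3) * D / sqrt delta * (potential (a / (D * delta)) - potential (b / (D * delta)))"
    using ab D delta H by (intro mult_left_mono potential_decrease) (auto simp: field_simps)
  moreover have "sqrt (H / 3) * D / sqrt delta * ((a / (D * delta) - b / (D * delta)) / (?gam * sqrt ?gam))
    = sqrt (H / 3) * (a - b) / (g * sqrt g)"
    using D delta g by (simp add: real_sqrt_divide diff_divide_distrib[symmetric] field_simps)
  moreover have "sqrt (H / 3 * g) * (a - b) / g\<^sup>2 = sqrt (H / 3) * (a - b) / (g * sqrt g)"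
  proof -
    have "g\<^sup>2 = g * sqrt g * sqrt g" using g by (simp add: power2_eq_square)
    then show ?thesis using g by (simp add: real_sqrt_mult[of "H / 3" g, simplified] del: real_sqrt_mult_self)
  qed
  ultimately show ?thesis by simp
qed

section \<open>Summation over the steps\<close>

theorem theorem5:
  fixes nrm :: "'a::euclidean_space \<Rightarrow> real"
    and f d psi :: "'a \<Rightarrow> real"
    and gf gd :: "'a \<Rightarrow> 'a"
    and Hf :: "'a \<Rightarrow> 'a \<Rightarrow> 'a"
    and Q :: "'a set"
    and L2 sigma H delta :: real
    and x Fp :: "nat \<Rightarrow> 'a"
    and xs :: 'a
    and N :: nat
  assumes norm: "is_norm nrm"
    and psi: "closed_convex_fun Q psi"
    and f_conv: "convex_on UNIV f"
    and f_grad: "\<And>z. (f has_derivative (\<lambda>h. gf z \<bullet> h)) (at z)"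
    and f_hess: "\<And>z. (gf has_derivative Hf z) (at z)"
    and hess_cont: "\<And>v. continuous_on UNIV (\<lambda>z. Hf z v)"
    and L2_nonneg: "L2 \<ge> 0"
    and hess_lip: "\<And>u v. u \<in> Q \<Longrightarrow> v \<in> Q \<Longrightarrow> op_norm nrm (\<lambda>h. Hf u h - Hf v h) \<le> L2 * nrm (u - v)"
    and sigma: "0 < sigma" "sigma \<le> 1"
    and d_grad: "\<And>z. (d has_derivative (\<lambda>h. gd z \<bullet> h)) (at z)"
    and d_sc: "\<And>u v. u \<in> Q \<Longrightarrow> v \<in> Q \<Longrightarrow> d v \<ge> d u + gd u \<bullet> (v - u) + sigma / 2 * (nrm (v - u))\<^sup>2"
    and d_lip: "\<And>u v. u \<in> Q \<Longrightarrow> v \<in> Q \<Longrightarrow> dual_norm nrm (gd u - gd v) \<le> nrm (u - v)"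
    and H: "H \<ge> L2" "H > 0"
    and x0: "x 0 \<in> Q"
    and Fp0: "Fp 0 \<in> subgrad Q (\<lambda>z. f z + psi z) (x 0)"
    and step: "\<And>k. k < N \<Longrightarrow>
       is_T Q f gf Hf d gd psi ((1 / sigma) * sqrt (H / 3 * dual_norm nrm (Fp k))) (x k) (x (Suc k))"
    and Fstep: "\<And>k. k < N \<Longrightarrow>
       Fp (Suc k) = gf (x (Suc k)) - gf (x k) - Hf (x k) (x (Suc k) - x k)
         - ((1 / sigma) * sqrt (H / 3 * dual_norm nrm (Fp k))) *\<^sub>R (gd (x (Suc k)) - gd (x k))"
    and xs: "xs \<in> Q" "\<And>z. z \<in> Q \<Longrightarrow> f xs + psi xs \<le> f z + psi z"
    and D_fin: "bdd_above {nrm (z - xs) | z. z \<in> Q \<and> f z + psi z \<le> f (x 0) + psi (x 0)}"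
    and delta: "delta > 0"
    and gk: "\<And>k. k \<le> N \<Longrightarrow> dual_norm nrm (Fp k) \<ge> delta"
  shows "let D = Sup {nrm (z - xs) | z. z \<in> Q \<and> f z + psi z \<le> f (x 0) + psi (x 0)};
             c = 1 / sigma + 3 * L2 / (2 * H)
         in real N \<le> 2 * c\<^sup>2 * sqrt (3 * H * D\<^sup>2 / delta)
                   + 3 / 2 * ln (dual_norm nrm (Fp 0) / delta) + ln c"
proof -
  define D where "D = Sup {nrm (z - xs) | z. z \<in> Q \<and> f z + psi z \<le> f (x 0) + psi (x 0)}"
  define c where "c = 1 / sigma + 3 * L2 / (2 * H)"
  define g where "g k = dual_norm nrm (Fp k)" for k
  define S where "S k = sqrt (H / 3 * g k)" for k
  define r where "r k = nrm (x (Suc k) - x k)" for k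
  define phi where "phi k = f (x k) + psi (x k) - (f xs + psi xs)" for k
  define K where "K = 2 * c\<^sup>2 * (sqrt (H / 3) * D / sqrt delta)"
  define W where "W k = potential (phi k / (D * delta))" for k
  have Q: "convex Q" and psi': "convex_on Q psi" using psi by (auto simp: closed_convex_fun_def)
  have gpos: "g k > 0" "delta \<le> g k" if "k \<le> N" for k using gk[OF that] delta by (auto simp: g_def)
  have dist_le: "nrm (z - xs) \<le> D" if "z \<in> Q" "f z + psi z \<le> f (x 0) + psi (x 0)" for z
    unfolding D_def by (rule cSup_upper[OF _ D_fin]) (use that in auto)
  have D0: "D \<ge> 0" using dist_le[OF x0] is_norm_nonneg[OF norm, of "x 0 - xs"] by simp
  have c1: "c \<ge> 1" using sigma L2_nonneg H(2) by (auto simp: c_def intro: add_increasing2)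

  have S_nonneg: "S k \<ge> 0" if "k \<le> N" for k using gpos[OF that] H(2) by (simp add: S_def)
  have AS: "1 / sigma * sqrt (H / 3 * dual_norm nrm (Fp k)) = S k / sigma" for k by (simp add: S_def g_def)
  \<comment> \<open>\<open>x 0\<close> minimizes \<open>f z - Fp 0 \<bullet> z + psi z\<close> over
    \<open>Q\<close>; its optimality condition extracts a subgradient of \<open>psi\<close> from one
    of \<open>f + psi\<close>, which starts the invariant \<open>inv\<close>.\<close>
  have "((\<lambda>z. f z - Fp 0 \<bullet> z) has_derivative (\<lambda>h. (gf (x 0) - Fp 0) \<bullet> h)) (at (x 0))"
    by (auto intro!: derivative_eq_intros f_grad simp: inner_diff_left)
  from composite_minimizer_optimality[OF Q psi' this x0]
  have base: "Fp 0 - gf (x 0) \<in> subgrad Q psi (x 0)"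
    using Fp0 by (fastforce simp: subgrad_def inner_diff_left inner_diff_right)
  have lip: "\<forall>u\<in>Q. \<forall>v\<in>Q. op_norm nrm (\<lambda>h. Hf u h - Hf v h) \<le> L2 * nrm (u - v)"
    and sc: "\<forall>u\<in>Q. \<forall>v\<in>Q. d v \<ge> d u + gd u \<bullet> (v - u) + sigma / 2 * (nrm (v - u))\<^sup>2"
    and dl: "\<forall>u\<in>Q. \<forall>v\<in>Q. dual_norm nrm (gd u - gd v) \<le> nrm (u - v)"
    using hess_lip d_sc d_lip by blast+
  note newton = newton_step[OF norm Q psi' f_conv f_grad f_hess L2_nonneg lip d_grad sc dl
    _ _ step[unfolded AS] _ Fstep[unfolded AS]]
  have inv: "x k \<in> Q \<and> Fp k - gf (x k) \<in> subgrad Q psi (x k)" if "k \<le> N" for k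
    using that
  proof (induction k)
    case (Suc k)
    then have k: "k < N" and xk: "x k \<in> Q" "Fp k - gf (x k) \<in> subgrad Q psi (x k)" by auto
    have "S k / sigma \<ge> 0" using S_nonneg[of k] k sigma by simp
    from newton(1,2)[OF this xk(1) k xk(2) k] show ?case by simp
  qed (use x0 base in simp)
  have stepk: "1 + 3/2 * ln (g (Suc k) / g k) \<le> 2 * c\<^sup>2 * (S k * (phi k - phi (Suc k)) / (g k)\<^sup>2)"
    and decr: "phi (Suc k) \<le> phi k" if k: "k < N" for k
  proof -
    have A0: "S k / sigma \<ge> 0" using S_nonneg[of k] k sigma by simp
    have xk: "x k \<in> Q" "Fp k - gf (x k) \<in> subgrad Q psi (x k)" using inv[of k] k by auto
    note n = newton(3-5)[OF A0 xk(1) k xk(2) k, folded r_def g_def]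
    have As: "S k / sigma * sigma = S k" using sigma by simp
    have Sr: "S k * r k \<le> g k" using n(1) unfolding As .
    have dec: "S k * (r k)\<^sup>2 - L2 * r k ^ 3 / 6 \<le> phi k - phi (Suc k)"
      using n(3) unfolding As phi_def by simp
    have r0: "r k \<ge> 0" by (simp add: r_def is_norm_nonneg[OF norm])
    show "1 + 3/2 * ln (g (Suc k) / g k) \<le> 2 * c\<^sup>2 * (S k * (phi k - phi (Suc k)) / (g k)\<^sup>2)"
      unfolding c_def
      by (rule scalar_step[OF H(2) L2_nonneg H(1) sigma gpos(1) gpos(1) r0 S_def Sr n(2) dec]) (use k in auto)
    \<comment> \<open>Otherwise \<open>H * r k\<close> would exceed \<open>3 * S k\<close>, and
      \<open>S k * r k \<le> g k\<close> would contradict \<open>S k * S k = H / 3 * g k\<close>.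
      The cubic loss is thus at most half of the quadratic gain, so all iterates stay in the level
      set measured by \<open>D\<close>.\<close>
    have "L2 * r k \<le> 3 * S k"
    proof (rule ccontr)
      assume "\<not> L2 * r k \<le> 3 * S k"
      then have "3 * S k < H * r k" using mult_right_mono[OF H(1) r0] by linarith
      moreover have Sp: "S k > 0" using gpos[of k] k H(2) by (simp add: S_def)
      ultimately have "S k * (3 * S k) < S k * (H * r k)" by simp
      also have "\<dots> \<le> H * g k" using mult_left_mono[OF Sr, of H] H(2) by (simp add: mult_ac)
      also have "\<dots> = S k * (3 * S k)"
      proof -
        have "S k * S k = H / 3 * g k" using gpos(1)[of k] k H(2) by (simp add: S_def)
        then show ?thesis by simp
      qed
      finally show False by simp
    qed
    from mult_right_mono[OF this, of "(r k)\<^sup>2"] have "L2 * r k ^ 3 / 6 \<le> S k * (r k)\<^sup>2"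
      using mult_nonneg_nonneg[OF S_nonneg[of k] zero_le_power2[of "r k"]] k
      by (simp add: power2_eq_square power3_eq_cube mult.assoc)
    with dec show "phi (Suc k) \<le> phi k" by linarith
  qed
  have phi_nonneg: "0 \<le> phi k" if "k \<le> N" for k using xs(2)[of "x k"] inv[OF that] by (simp add: phi_def)
  have phi_le0: "phi k \<le> phi 0" if "k \<le> N" for k
    using that by (induction k) (auto intro: order_trans[OF decr])
  have phi_le: "phi k \<le> g k * D" if k: "k \<le> N" for k
  proof -
    have xk: "x k \<in> Q" "psi (x k) + (Fp k - gf (x k)) \<bullet> (xs - x k) \<le> psi xs"
      using inv[OF k] xs(1) by (auto simp: subgrad_def)
    have "phi k \<le> Fp k \<bullet> (x k - xs)"
      using xk(2) convex_on_above_gradient[OF f_conv f_grad, of "x k" xs]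
      by (simp add: phi_def inner_diff_left inner_diff_right)
    also have "\<dots> \<le> g k * nrm (x k - xs)" unfolding g_def by (rule inner_le_dual_norm[OF norm])
    also have "\<dots> \<le> g k * D"
      using gpos(1)[OF k] dist_le[OF xk(1)] phi_le0[OF k] by (intro mult_left_mono) (auto simp: phi_def)
    finally show ?thesis .
  qed
  \<comment> \<open>Logarithms of gradient ratios and differences of potentials telescope
    together.\<close>
  have tele: "real n + 3/2 * ln (g n / g 0) \<le> K * (W 0 - W n)" if "n \<le> N" for n
    using that
  proof (induction n)
    case (Suc n)
    have "S n * (phi n - phi (Suc n)) / (g n)\<^sup>2 \<le> sqrt (H / 3) * D / sqrt delta * (W n - W (Suc n))"
      unfolding S_def W_def using Suc.prems
      by (intro potential_step H D0 delta gpos phi_nonneg decr phi_le) auto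
    then have "1 + 3/2 * ln (g (Suc n) / g n) \<le> K * (W n - W (Suc n))"
      using stepk[of n] Suc.prems mult_left_mono[of _ _ "2 * c\<^sup>2"] unfolding K_def by fastforce
    moreover have "ln (g (Suc n) / g 0) = ln (g (Suc n) / g n) + ln (g n / g 0)"
      using gpos[of n] gpos[of 0] gpos[of "Suc n"] Suc.prems by (simp add: ln_div)
    ultimately show ?case using Suc.IH Suc.prems by (simp add: algebra_simps)
  qed (use gpos[of 0] in simp)
  have "K \<ge> 0" using D0 H(2) delta by (simp add: K_def)
  \<comment> \<open>The potential lies between 0 and 3 whatever the initial gap; this 3 turns
    \<open>sqrt (H / 3)\<close> into \<open>sqrt (3 * H)\<close>.\<close>
  moreover have "W 0 - W N \<le> 3"
    using potential_le[of "phi 0 / (D * delta)"] potential_nonneg[of "phi N / (D * delta)"]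
      phi_nonneg[of N] D0 delta by (simp add: W_def)
  ultimately have "K * (W 0 - W N) \<le> K * 3" by (intro mult_left_mono)
  also have "K * 3 = 2 * c\<^sup>2 * sqrt (3 * H * D\<^sup>2 / delta)"
  proof -
    have "sqrt (H / 3) * 3 = sqrt (3 * H)"
      using real_sqrt_mult[of "H / 3" 9] real_sqrt_mult[of 3 3] by simp
    moreover have "sqrt (3 * H * D\<^sup>2 / delta) = sqrt (3 * H) * D / sqrt delta"
      using D0 by (simp add: real_sqrt_divide real_sqrt_mult)
    moreover have "K * 3 = 2 * c\<^sup>2 * ((sqrt (H / 3) * 3) * D / sqrt delta)" by (simp add: K_def)
    ultimately show ?thesis by simp
  qed
  finally have "real N + 3/2 * ln (g N / g 0) \<le> 2 * c\<^sup>2 * sqrt (3 * H * D\<^sup>2 / delta)"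
    using tele[of N] by simp
  \<comment> \<open>The sum is \<open>ln (g N / delta)\<close>, so the last gradient bound lets
    \<open>g N\<close> be replaced by \<open>delta\<close>.\<close>
  moreover have "ln (g 0 / delta) + ln (g N / g 0) \<ge> 0"
    using gpos[of 0] gpos[of N] delta by (simp add: ln_div)
  moreover have "ln c \<ge> 0" using c1 by simp
  ultimately show ?thesis
    unfolding Let_def D_def[symmetric] c_def[symmetric] g_def[symmetric] by argo
qed

end
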